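(* Let $a$ and $b$ be nonnegative reals such that $a \neq 0$. Then the general continued fraction with sequences $n \mapsto an^2 + bn + 1$ and $n \mapsto -an^2 - bn$ ($n \geq 1$) exists and $$[an^2 + bn + 1 : -an^2 - bn] = \frac{F(a, b) + 2(2a + b)(a + b + 1)}{F(a, b) + 2(2a + b)},$$ where $$F(a, b) = 2 \sum_{k \geq 0} \frac{1}{(k + 2)!\, (3 + b / a)^{\overline{k}}\, a^k}.$$
   Context: Given two sequences $a(n)$ and $b(n)$ ($n \geq 1$) and an integer $m \geq 1$, the $m$th convergent of their general continued fraction is defined recursively by $[a(n) : b(n)]_1 = a(1)$ and $$[a(n) : b(n)]_{m+1} = a(1) + \frac{b(1)}{[a(n+1) : b(n+1)]_m}, \quad m \geq 1,$$ whenever these expressions are well-defined (no division by zero occurs in the nested expression); here $[a(n+1):b(n+1)]_m$ is the $m$th convergent for the shifted sequences $n \mapsto a(n+1)$, $n \mapsto b(n+1)$. If all convergents are well-defined and $\lim_{m\to\infty} [a(n):b(n)]_m$ exists, the general continued fraction is $$[a(n) : b(n)] = \lim_{m \to \infty} [a(n):b(n)]_m = a(1) + \cfrac{b(1)}{a(2) + \cfrac{b(2)}{a(3) + \cdots}}.$$ In this notation $n$ is always the sequence variable and other letters are parameters (so in the claim $a,b$ are real numbers). The rising factorial is $x^{\overline{k}} = x(x+1)\cdots(x+k-1)$, with $x^{\overline{0}} = 1$. *)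

theory Defs
  imports Complex_Main
begin

text \<open>
  Sequences are 1-based: \<open>a 0\<close>, \<open>b 0\<close> and the \<open>0\<close>th convergent are never used
  (the latter is left unspecified).  Since \<open>x / 0 = 0\<close> in HOL, \<open>gcf_convergent\<close> is only
  meaningful where \<open>gcf_well_defined\<close> holds.
\<close>

fun gcf_convergent :: "(nat \<Rightarrow> real) \<Rightarrow> (nat \<Rightarrow> real) \<Rightarrow> nat \<Rightarrow> real" where
  "gcf_convergent a b (Suc 0) = a 1"
| "gcf_convergent a b (Suc (Suc m)) =
     a 1 + b 1 / gcf_convergent (\<lambda>n. a (n + 1)) (\<lambda>n. b (n + 1)) (Suc m)"

fun gcf_well_defined :: "(nat \<Rightarrow> real) \<Rightarrow> (nat \<Rightarrow> real) \<Rightarrow> nat \<Rightarrow> bool" where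
  "gcf_well_defined a b (Suc 0) \<longleftrightarrow> True"
| "gcf_well_defined a b (Suc (Suc m)) \<longleftrightarrow>
     gcf_well_defined (\<lambda>n. a (n + 1)) (\<lambda>n. b (n + 1)) (Suc m) \<and>
     gcf_convergent (\<lambda>n. a (n + 1)) (\<lambda>n. b (n + 1)) (Suc m) \<noteq> 0"

definition gcf_exists :: "(nat \<Rightarrow> real) \<Rightarrow> (nat \<Rightarrow> real) \<Rightarrow> bool" where
  "gcf_exists a b \<longleftrightarrow>
     (\<forall>m\<ge>1. gcf_well_defined a b m) \<and> convergent (gcf_convergent a b)"

definition gcf :: "(nat \<Rightarrow> real) \<Rightarrow> (nat \<Rightarrow> real) \<Rightarrow> real" where
  "gcf a b = lim (gcf_convergent a b)"

definition F_term :: "real \<Rightarrow> real \<Rightarrow> nat \<Rightarrow> real" where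
  "F_term a b k = 1 / (fact (k + 2) * pochhammer (3 + b / a) k * a ^ k)"

definition F :: "real \<Rightarrow> real \<Rightarrow> real" where
  "F a b = 2 * (\<Sum>k. F_term a b k)"

end

theory Submission imports Defs begin

text \<open>
  Put \<open>c n = a n\<^sup>2 + b n\<close>.  The tails of the continued fraction satisfy
  \<open>x = 1 + c n - c n / x'\<close>, and with \<open>u = 1 / (x - 1)\<close> this becomes \<open>u = (1 + u') / c n\<close>.
  So the \<open>m\<close>th convergent is \<open>1 + 1 / E\<close>, where
  \<open>E = 1 / c 1 + 1 / (c 1 c 2) + \<dots> + 1 / (c 1 \<dots> c m)\<close> (Euler).  The products are
  \<open>c 1 \<dots> c i = i! a\<^sup>i (1 + b / a)(2 + b / a) \<dots> (i + b / a)\<close>; hence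
  \<open>(a + b) (2 a + b) E\<close> tends to \<open>2 a + b + F a b / 2\<close>.
\<close>

definition euler_sum :: "(nat \<Rightarrow> real) \<Rightarrow> nat \<Rightarrow> real" where
  "euler_sum c m = (\<Sum>i<m. 1 / (\<Prod>k<Suc i. c (Suc k)))"

text \<open>Every product contains the factor \<open>c 1\<close>. Once it is taken out, the first
  term leaves the empty product 1 and the others form the sum of the shifted sequence. This is the
  recursion \<open>u = (1 + u') / c n\<close>.\<close>

lemma euler_sum_Suc_shift:
  "euler_sum c (Suc m) = (1 + euler_sum (\<lambda>n. c (n + 1)) m) / c 1"
  unfolding euler_sum_def
  by (simp add: sum.lessThan_Suc_shift prod.lessThan_Suc_shift sum_distrib_left add_divide_distrib
      sum_divide_distrib mult.commute del: sum.lessThan_Suc prod.lessThan_Suc)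

lemma euler_sum_nonneg:
  assumes "\<And>n. n \<ge> 1 \<Longrightarrow> c n > 0"
  shows "euler_sum c m \<ge> 0"
  unfolding euler_sum_def using assms
  by (intro sum_nonneg divide_nonneg_nonneg prod_nonneg) (auto intro: less_imp_le)

text \<open>Convergents and Euler sums both recurse through the shifted sequence, so the induction
  must generalise over \<open>c\<close>.\<close>

lemma gcf_convergent_euler:
  assumes "\<And>n. n \<ge> 1 \<Longrightarrow> c n > 0"
  shows "gcf_convergent (\<lambda>n. c n + 1) (\<lambda>n. - c n) (Suc m) = 1 + 1 / euler_sum c (Suc m)"
  using assms
proof (induction m arbitrary: c)
  case 0
  then show ?case by (simp add: euler_sum_def)
next
  case (Suc m)
  let ?c = "\<lambda>n. c (n + 1)"
  define u where "u = euler_sum ?c (Suc m)"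
  have pos: "?c n > 0" if "n \<ge> 1" for n using Suc.prems by simp
  have c1: "c 1 > 0" using Suc.prems by simp
  \<comment> \<open>Taking off one more term writes \<open>u\<close> as 1 plus a nonnegative sum,
    divided by the positive \<open>c 2\<close>.\<close>
  have "u > 0"
    using euler_sum_nonneg[of "\<lambda>n. ?c (n + 1)" m] Suc.prems
    unfolding u_def euler_sum_Suc_shift[of ?c] by (simp add: add_pos_nonneg)
  have IH: "gcf_convergent (\<lambda>n. ?c n + 1) (\<lambda>n. - ?c n) (Suc m) = 1 + 1 / u"
    unfolding u_def by (rule Suc.IH) (rule pos)
  have "gcf_convergent (\<lambda>n. c n + 1) (\<lambda>n. - c n) (Suc (Suc m)) = c 1 + 1 + - c 1 / (1 + 1 / u)"
    by (simp only: gcf_convergent.simps IH)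
  \<comment> \<open>Since \<open>1 / (1 + 1 / u) = u / (1 + u)\<close>, the difference
    \<open>c 1 - c 1 * u / (1 + u)\<close> collapses to \<open>c 1 / (1 + u)\<close>.\<close>
  also have "\<dots> = 1 + 1 / ((1 + u) / c 1)"
    using c1 \<open>u > 0\<close> by (simp add: field_simps)
  also have "(1 + u) / c 1 = euler_sum c (Suc (Suc m))"
    by (simp only: euler_sum_Suc_shift[of c] u_def)
  finally show ?case .
qed

text \<open>Each nested denominator is a convergent of a shifted sequence, hence 1 plus a
  nonnegative number, and cannot vanish.\<close>

lemma gcf_well_defined_euler:
  assumes "\<And>n. n \<ge> 1 \<Longrightarrow> c n > 0"
  shows "gcf_well_defined (\<lambda>n. c n + 1) (\<lambda>n. - c n) (Suc m)"
  using assms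
proof (induction m arbitrary: c)
  case 0
  then show ?case by simp
next
  case (Suc m)
  let ?c = "\<lambda>n. c (n + 1)"
  have pos: "?c n > 0" if "n \<ge> 1" for n using Suc.prems by simp
  have "gcf_convergent (\<lambda>n. ?c n + 1) (\<lambda>n. - ?c n) (Suc m) = 1 + 1 / euler_sum ?c (Suc m)"
    by (rule gcf_convergent_euler) (rule pos)
  moreover have "1 / euler_sum ?c (Suc m) \<ge> 0"
    using euler_sum_nonneg[of ?c "Suc m"] pos by simp
  ultimately have "gcf_convergent (\<lambda>n. ?c n + 1) (\<lambda>n. - ?c n) (Suc m) \<noteq> 0" by linarith
  moreover have "gcf_well_defined (\<lambda>n. ?c n + 1) (\<lambda>n. - ?c n) (Suc m)"
    by (rule Suc.IH) (rule pos)
  ultimately show ?case by simp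
qed

lemma gcf_euler:
  assumes "\<And>n. n \<ge> 1 \<Longrightarrow> c n > 0" and "euler_sum c \<longlonglongrightarrow> s" and "s \<noteq> 0"
  shows "gcf_exists (\<lambda>n. c n + 1) (\<lambda>n. - c n)"
    and "gcf (\<lambda>n. c n + 1) (\<lambda>n. - c n) = 1 + 1 / s"
proof -
  have "(\<lambda>m. 1 + 1 / euler_sum c (Suc m)) \<longlonglongrightarrow> 1 + 1 / s"
    using assms(2,3) by (intro tendsto_intros LIMSEQ_Suc)
  then have "(\<lambda>m. gcf_convergent (\<lambda>n. c n + 1) (\<lambda>n. - c n) (Suc m)) \<longlonglongrightarrow> 1 + 1 / s"
    using assms(1) by (simp only: gcf_convergent_euler)
  \<comment> \<open>The limit ignores index 0, where the convergent is unspecified.\<close>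
  then have lim: "gcf_convergent (\<lambda>n. c n + 1) (\<lambda>n. - c n) \<longlonglongrightarrow> 1 + 1 / s"
    by (rule LIMSEQ_imp_Suc)
  show "gcf (\<lambda>n. c n + 1) (\<lambda>n. - c n) = 1 + 1 / s"
    unfolding gcf_def using lim by (rule limI)
  have "gcf_well_defined (\<lambda>n. c n + 1) (\<lambda>n. - c n) m" if "m \<ge> 1" for m
    using gcf_well_defined_euler[of c "m - 1"] assms(1) that by simp
  then show "gcf_exists (\<lambda>n. c n + 1) (\<lambda>n. - c n)"
    unfolding gcf_exists_def using lim by (auto simp: convergent_def)
qed

lemma pochhammer_ge_1:
  fixes x :: real
  assumes "x \<ge> 1"
  shows "pochhammer x k \<ge> 1"
  unfolding pochhammer_prod using assms by (intro prod_ge_1) auto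

lemma F_term_nonneg:
  assumes "a > 0" and "b \<ge> 0"
  shows "F_term a b k \<ge> 0"
  using assms pochhammer_ge_1[of "3 + b / a" k] by (simp add: F_term_def)

text \<open>The terms are dominated by those of the exponential series at \<open>1 / a\<close>,
  because \<open>(k + 2)!\<close> is at least \<open>k!\<close> and the rising factorial is at least
  1.\<close>

lemma summable_F_term:
  assumes "a > 0" and "b \<ge> 0"
  shows "summable (F_term a b)"
proof (rule summable_comparison_test')
  show "summable (\<lambda>k. inverse (fact k) * (1 / a) ^ k)"
    by (rule summable_exp)
  fix k :: nat
  have "fact k * 1 \<le> fact (k + 2) * pochhammer (3 + b / a) k"
    using assms by (intro mult_mono fact_mono pochhammer_ge_1) auto
  then have "1 / (fact (k + 2) * pochhammer (3 + b / a) k * a ^ k) \<le> 1 / (fact k * a ^ k)"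
    using assms
    by (intro divide_left_mono mult_right_mono mult_pos_pos pochhammer_pos add_pos_nonneg) auto
  then show "norm (F_term a b k) \<le> inverse (fact k) * (1 / a) ^ k"
    using F_term_nonneg[OF assms, of k]
    by (simp add: F_term_def power_divide field_simps)
qed

lemma prod_quadratic:
  fixes a b :: real
  assumes "a \<noteq> 0"
  shows "(\<Prod>k<n. a * (real (Suc k))\<^sup>2 + b * real (Suc k)) = fact n * a ^ n * pochhammer (1 + b / a) n"
proof (induction n)
  case (Suc n)
  have "a * (real (Suc n))\<^sup>2 + b * real (Suc n) = real (Suc n) * a * (1 + b / a + real n)"
    using assms by (simp add: field_simps power2_eq_square)
  with Suc show ?case by (simp add: pochhammer_Suc del: of_nat_Suc)
qed simp

text \<open>The first term \<open>1 / (a + b)\<close> stands alone. In each later product the two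
  lowest factors of \<open>pochhammer (1 + b / a) (k + 2)\<close> absorb \<open>a ^ 2\<close> and
  become \<open>(a + b) * (2 * a + b)\<close>; what remains is the denominator of
  \<open>F_term a b k\<close>.\<close>

lemma euler_sum_quadratic:
  fixes a b :: real
  assumes "a > 0" and "b \<ge> 0"
  shows "euler_sum (\<lambda>n. a * (real n)\<^sup>2 + b * real n) (Suc m) =
    1 / (a + b) + (\<Sum>k<m. F_term a b k) / ((a + b) * (2 * a + b))"
proof -
  have "1 / (fact (k + 2) * a ^ (k + 2) * pochhammer (1 + b / a) (k + 2)) =
      F_term a b k / ((a + b) * (2 * a + b))" for k
  proof -
    have q: "a\<^sup>2 * ((1 + b / a) * (2 + b / a)) = (a + b) * (2 * a + b)"
      using assms by (simp add: field_simps power2_eq_square)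
    have p: "pochhammer (1 + b / a) (k + 2) =
        (1 + b / a) * (2 + b / a) * pochhammer (3 + b / a) k"
      by (simp add: pochhammer_rec add.assoc add.left_commute)
    have "fact (k + 2) * a ^ (k + 2) * pochhammer (1 + b / a) (k + 2) =
        fact (k + 2) * pochhammer (3 + b / a) k * a ^ k * (a\<^sup>2 * ((1 + b / a) * (2 + b / a)))"
      by (simp only: p power_add mult_ac)
    also note q
    finally have "fact (k + 2) * a ^ (k + 2) * pochhammer (1 + b / a) (k + 2) =
        fact (k + 2) * pochhammer (3 + b / a) k * a ^ k * ((a + b) * (2 * a + b))" .
    then show ?thesis by (simp only: F_term_def divide_divide_eq_left)
  qed
  moreover have "fact 1 * a ^ 1 * pochhammer (1 + b / a) 1 = a + b"
    using assms by (simp add: field_simps)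
  ultimately show ?thesis
    using assms
    by (simp add: euler_sum_def prod_quadratic sum.lessThan_Suc_shift sum_divide_distrib
        del: sum.lessThan_Suc prod.lessThan_Suc of_nat_Suc pochhammer_Suc fact_Suc power_Suc)
qed

theorem theorem2:
  fixes a b :: real
  assumes "a \<ge> 0" and "b \<ge> 0" and "a \<noteq> 0"
  shows "summable (F_term a b) \<and>
    gcf_exists (\<lambda>n. a * (real n)\<^sup>2 + b * real n + 1) (\<lambda>n. - a * (real n)\<^sup>2 - b * real n) \<and>
    gcf (\<lambda>n. a * (real n)\<^sup>2 + b * real n + 1) (\<lambda>n. - a * (real n)\<^sup>2 - b * real n) =
      (F a b + 2 * (2 * a + b) * (a + b + 1)) / (F a b + 2 * (2 * a + b))"
proof -
  have a: "a > 0" using assms by simp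
  define c where "c = (\<lambda>n. a * (real n)\<^sup>2 + b * real n)"
  define G where "G = (\<Sum>k. F_term a b k)"
  define s where "s = 1 / (a + b) + G / ((a + b) * (2 * a + b))"
  have summ: "summable (F_term a b)" by (rule summable_F_term[OF a assms(2)])
  have G: "G \<ge> 0" unfolding G_def by (intro suminf_nonneg summ F_term_nonneg a assms)
  have ab: "a + b > 0" "2 * a + b > 0" using a assms(2) by auto
  have s: "s > 0" unfolding s_def using G ab by (simp add: add_pos_nonneg)
  have c: "c n > 0" if "n \<ge> 1" for n
    unfolding c_def using a assms(2) that by (simp add: add_pos_nonneg)
  have "(\<lambda>m. euler_sum c (Suc m)) \<longlonglongrightarrow> s"
    unfolding c_def euler_sum_quadratic[OF a assms(2)] s_def G_def
    using ab by (intro tendsto_intros summable_LIMSEQ summ) auto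
  then have lim: "euler_sum c \<longlonglongrightarrow> s" by (rule LIMSEQ_imp_Suc)
  have eq: "(\<lambda>n. a * (real n)\<^sup>2 + b * real n + 1) = (\<lambda>n. c n + 1)"
    "(\<lambda>n. - a * (real n)\<^sup>2 - b * real n) = (\<lambda>n. - c n)"
    unfolding c_def by auto
  have "s = (2 * a + b + G) / ((a + b) * (2 * a + b))"
    unfolding s_def add_divide_distrib[of "2 * a + b"] using ab by simp
  then have "1 + 1 / s = 1 + (a + b) * (2 * a + b) / (2 * a + b + G)" by simp
  also have "\<dots> = (G + (2 * a + b) * (a + b + 1)) / (G + (2 * a + b))"
    using ab G by (simp add: field_simps)
  \<comment> \<open>Doubling both sides of the fraction turns \<open>G\<close> into
    \<open>F a b\<close>, which is \<open>2 * G\<close>.\<close>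
  also have "\<dots> = (2 * (G + (2 * a + b) * (a + b + 1))) / (2 * (G + (2 * a + b)))"
    by (rule mult_divide_mult_cancel_left[symmetric]) simp
  also have "\<dots> = (F a b + 2 * (2 * a + b) * (a + b + 1)) / (F a b + 2 * (2 * a + b))"
    unfolding F_def G_def by (simp only: distrib_left distrib_right mult.assoc)
  finally show ?thesis
    unfolding eq using summ gcf_euler[OF c lim] s by simp
qed

end
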